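(* Let $X$ be a real Banach space with continuous dual $X^*$, let $A,B\colon X\rightrightarrows X^*$ be maximally monotone linear relations, and suppose that $\operatorname{dom}A-\operatorname{dom}B$ is closed in $X$. Then $A+B$ is maximally monotone.
   Context: A set-valued operator $A\colon X\rightrightarrows X^*$ assigns to each $x\in X$ a subset $Ax\subseteq X^*$; $\operatorname{gra}A:=\{(x,x^* )\in X\times X^*\mid x^*\in Ax\}$ and $\operatorname{dom}A:=\{x\in X\mid Ax\ne\varnothing\}$. $A$ is monotone if $\langle x-y,x^*-y^*\rangle\ge 0$ for all $(x,x^* ),(y,y^* )\in\operatorname{gra}A$, and maximally monotone if it is monotone and no monotone operator has a graph strictly containing $\operatorname{gra}A$. $A$ is a linear relation if $\operatorname{gra}A$ is a linear subspace. The sum is $(A+B)x:=Ax+Bx=\{a^*+b^*\mid a^*\in Ax,\ b^*\in Bx\}$. $\operatorname{dom}A-\operatorname{dom}B=\{a-b\mid a\in\operatorname{dom}A,\ b\in\operatorname{dom}B\}$; closed means norm closed. *)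

theory Defs
  imports "HOL-Analysis.Analysis"
begin

text \<open>
  The continuous dual of a real Banach space \<open>'a\<close> is the type of bounded linear
  functionals, and the duality pairing of \<open>x\<close> and \<open>x'\<close> is \<open>blinfun_apply x' x\<close>.
\<close>

type_synonym 'a dual = "'a \<Rightarrow>\<^sub>L real"

type_synonym 'a set_valued = "'a \<Rightarrow> 'a dual set"

definition gra :: "'a::real_normed_vector set_valued \<Rightarrow> ('a \<times> 'a dual) set"
  where "gra A = {(x, x'). x' \<in> A x}"

definition op_dom :: "'a::real_normed_vector set_valued \<Rightarrow> 'a set"
  where "op_dom A = {x. A x \<noteq> {}}"

definition monotone_op :: "'a::real_normed_vector set_valued \<Rightarrow> bool"
  where "monotone_op A \<longleftrightarrow>
    (\<forall>(x, x') \<in> gra A. \<forall>(y, y') \<in> gra A. blinfun_apply (x' - y') (x - y) \<ge> 0)"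

definition maximally_monotone :: "'a::real_normed_vector set_valued \<Rightarrow> bool"
  where "maximally_monotone A \<longleftrightarrow>
    monotone_op A \<and> \<not> (\<exists>B. monotone_op B \<and> gra A \<subset> gra B)"

definition linear_relation :: "'a::real_normed_vector set_valued \<Rightarrow> bool"
  where "linear_relation A \<longleftrightarrow> subspace (gra A)"

definition op_sum :: "'a::real_normed_vector set_valued \<Rightarrow> 'a set_valued \<Rightarrow> 'a set_valued"
  where "op_sum A B = (\<lambda>x. {a' + b' | a' b'. a' \<in> A x \<and> b' \<in> B x})"

end

theory Submission
  imports Defs
begin

text \<open>
  If \<open>(z, v)\<close> is monotonically related to \<open>A + B\<close>, one looks for a splitting
  \<open>v = u + (v - u)\<close> with
  \<open>\<langle>z - a, u - a'\<rangle> + \<langle>z - b, (v - u) - b'\<rangle> \<ge> 0\<close> for all \<open>(a, a') \<in> gra A\<close> and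
  \<open>(b, b') \<in> gra B\<close>; by maximality this forces \<open>u \<in> A z\<close> and \<open>v - u \<in> B z\<close>.
  The inequality asks that \<open>\<langle>a - b, u\<rangle>\<close> be dominated by a function of \<open>((a, a'), (b, b'))\<close>
  that is convex because \<open>A\<close> and \<open>B\<close> are linear and monotone, and that is nonnegative when
  \<open>a = b\<close>. Such a continuous \<open>u\<close> exists by the Hahn--Banach theorem once the function is bounded
  below by a multiple of \<open>- \<parallel>a - b\<parallel>\<close>, and this bound comes from the open mapping theorem for
  \<open>((a, a'), (b, b')) \<mapsto> a - b\<close>, a surjection from the closed subspace \<open>gra A \<times> gra B\<close> onto
  the closed subspace \<open>dom A - dom B\<close>.
\<close>

section \<open>Linear minorants of sublinear functions\<close>

text \<open>Homogeneity is stated as an inequality for \<open>c > 0\<close>, the form that is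
  directly checked for infima; applying it to \<open>inverse c\<close> as well recovers
  equality.\<close>

definition sublinear :: "('a::real_vector \<Rightarrow> real) \<Rightarrow> bool"
  where "sublinear p \<longleftrightarrow>
    (\<forall>x y. p (x + y) \<le> p x + p y) \<and> (\<forall>c>0. \<forall>x. p (c *\<^sub>R x) \<le> c * p x)"

lemma sublinear_add: "sublinear p \<Longrightarrow> p (x + y) \<le> p x + p y"
  by (simp add: sublinear_def)

lemma sublinear_zero:
  assumes "sublinear p"
  shows "p 0 = 0"
proof -
  have "p 0 \<le> p 0 + p 0"
    using sublinear_add[OF assms, of 0 0] by simp
  moreover have "p ((1/2) *\<^sub>R 0) \<le> (1/2) * p 0"
    using assms unfolding sublinear_def by (metis half_gt_zero zero_less_one)
  ultimately show ?thesis
    by simp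
qed

lemma sublinear_scaleR:
  assumes "sublinear p" "0 \<le> c"
  shows "p (c *\<^sub>R x) = c * p x"
proof (cases "c = 0")
  case True
  then show ?thesis
    by (simp add: sublinear_zero[OF assms(1)])
next
  case False
  with assms(2) have c: "c > 0"
    by simp
  have le: "\<And>c x. c > 0 \<Longrightarrow> p (c *\<^sub>R x) \<le> c * p x"
    using assms(1) by (simp add: sublinear_def)
  have "p (inverse c *\<^sub>R c *\<^sub>R x) \<le> inverse c * p (c *\<^sub>R x)"
    using c by (intro le) simp
  then have "c * p x \<le> p (c *\<^sub>R x)"
    using c by (simp add: field_simps)
  with le[OF c] show ?thesis
    by (simp add: order_antisym)
qed

lemma sublinear_minus:
  assumes "sublinear p"
  shows "- p (- x) \<le> p x"
  using sublinear_add[OF assms, of x "- x"] sublinear_zero[OF assms] by simp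

text \<open>The index \<open>k\<close> on the left may depend on all the data, so chains and
  families indexed by a cone are both covered. The minorant \<open>m\<close> makes the real infimum
  a genuine lower bound.\<close>

lemma sublinear_INF:
  fixes F :: "'i \<Rightarrow> 'a::real_vector \<Rightarrow> real"
  assumes ne: "I \<noteq> {}"
    and low: "\<And>i x. i \<in> I \<Longrightarrow> m x \<le> F i x"
    and add: "\<And>i j x y. i \<in> I \<Longrightarrow> j \<in> I \<Longrightarrow> \<exists>k\<in>I. F k (x + y) \<le> F i x + F j y"
    and scale: "\<And>i c x. i \<in> I \<Longrightarrow> c > 0 \<Longrightarrow> \<exists>k\<in>I. F k (c *\<^sub>R x) \<le> c * F i x"
  shows "sublinear (\<lambda>x. INF i\<in>I. F i x)"
proof -
  let ?p = "\<lambda>x. INF i\<in>I. F i x"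
  have bdd: "bdd_below ((\<lambda>i. F i x) ` I)" for x
    using low by (intro bdd_belowI2[where m = "m x"])
  have le: "?p x \<le> F i x" if "i \<in> I" for i x
    using bdd that by (rule cINF_lower)
  have "?p (x + y) \<le> ?p x + ?p y" for x y
  proof -
    have "?p (x + y) \<le> F i x + F j y" if "i \<in> I" "j \<in> I" for i j
      using add[OF that, of x y] le order_trans by blast
    then have "?p (x + y) - F j y \<le> ?p x" if "j \<in> I" for j
      using that ne by (intro cINF_greatest) (auto simp: algebra_simps)
    then have "?p (x + y) - ?p x \<le> ?p y"
      using ne by (intro cINF_greatest) (auto simp: algebra_simps)
    then show ?thesis
      by simp
  qed
  moreover have "?p (c *\<^sub>R x) \<le> c * ?p x" if c: "c > 0" for c x
  proof -
    have "?p (c *\<^sub>R x) \<le> c * F i x" if "i \<in> I" for i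
      using scale[OF that c, of x] le order_trans by blast
    then have "?p (c *\<^sub>R x) / c \<le> ?p x"
      using ne c by (intro cINF_greatest) (auto simp: field_simps)
    then show ?thesis
      using c by (simp add: field_simps)
  qed
  ultimately show ?thesis
    by (simp add: sublinear_def)
qed

text \<open>If \<open>p\<close> failed to be superadditive in the direction \<open>y\<close>, it
  could be lowered to another sublinear function; minimality excludes this, and additivity then
  gives homogeneity for negative scalars.\<close>

lemma minimal_sublinear_imp_linear:
  assumes p: "sublinear p"
    and min: "\<And>q. sublinear q \<Longrightarrow> (\<And>x. q x \<le> p x) \<Longrightarrow> q = p"
  shows "linear p"
proof -
  have super: "p x + p y \<le> p (x + y)" for x y
  proof -
    \<comment> \<open>The infimum over \<open>t \<ge> 0\<close> is sublinear, and
      \<open>t = 0\<close> shows that it lies below \<open>p\<close>. By minimality it equals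
      \<open>p\<close>, and then \<open>t = 1\<close> reads
      \<open>p x \<le> p (x + y) - p y\<close>.\<close>
    define F where "F = (\<lambda>t x. p (x + t *\<^sub>R y) - t * p y)"
    have low: "- p (- x) \<le> F t x" if "t \<in> {0..}" for t x
      using sublinear_add[OF p, of "x + t *\<^sub>R y" "- x"] sublinear_scaleR[OF p, of t y] that
      by (simp add: F_def)
    have add: "\<exists>k\<in>{0..}. F k (x + x') \<le> F s x + F t x'"
      if "s \<in> {0..}" "t \<in> {0..}" for s t x x'
      using sublinear_add[OF p, of "x + s *\<^sub>R y" "x' + t *\<^sub>R y"] that
      by (intro bexI[of _ "s + t"]) (auto simp: F_def algebra_simps)
    have scale: "\<exists>k\<in>{0..}. F k (c *\<^sub>R x) \<le> c * F t x" if "t \<in> {0..}" "c > 0" for t c x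
      using sublinear_scaleR[OF p, of c "x + t *\<^sub>R y"] that
      by (intro bexI[of _ "c * t"]) (auto simp: F_def algebra_simps)
    let ?q = "\<lambda>x. INF t\<in>{0..}. F t x"
    have q: "sublinear ?q"
      by (rule sublinear_INF[OF _ low add scale]) auto
    have q_le: "?q x \<le> F t x" if "t \<ge> 0" for t x
      using that low by (auto intro!: cINF_lower bdd_belowI2)
    have "?q x \<le> p x" for x
      using q_le[of 0 x] by (simp add: F_def)
    with q have "?q = p"
      by (intro min) auto
    moreover have "?q x \<le> p (x + y) - p y"
      using q_le[of 1 x] by (simp add: F_def)
    ultimately show ?thesis
      by (metis add_le_imp_le_diff le_diff_eq)
  qed
  have add: "p (x + y) = p x + p y" for x y
    using super[of x y] sublinear_add[OF p, of x y] by simp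
  have minus: "p (- x) = - p x" for x
    using add[of x "- x"] sublinear_zero[OF p] by simp
  have "p (c *\<^sub>R x) = c * p x" for c x
  proof (cases "c \<ge> 0")
    case True
    then show ?thesis
      by (rule sublinear_scaleR[OF p])
  next
    case False
    then have "p ((- c) *\<^sub>R x) = - c * p x"
      by (intro sublinear_scaleR[OF p]) simp
    then show ?thesis
      using minus[of "c *\<^sub>R x"] by simp
  qed
  with add show ?thesis
    by (intro linearI) auto
qed

text \<open>Hahn--Banach in minimal form: Zorn's lemma gives a minimal sublinear function below
  \<open>p\<close>, which is linear by the preceding lemma.\<close>

theorem sublinear_has_linear_minorant:
  assumes p: "sublinear p"
  obtains f where "linear f" "\<And>x. f x \<le> p x"
proof -
  define S where "S = {q. sublinear q \<and> q \<le> p}"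
  have "\<exists>m\<in>S. \<forall>q\<in>S. m \<ge> q \<longrightarrow> q = m"
  proof (rule predicate_Zorn)
    show "partial_order_on S (relation_of (\<ge>) S)"
      by (rule partial_order_on_relation_ofI) auto
  next
    fix C assume C: "C \<in> Chains (relation_of (\<ge>) S)"
    then have CS: "C \<subseteq> S" and total: "\<And>q r. q \<in> C \<Longrightarrow> r \<in> C \<Longrightarrow> q \<le> r \<or> r \<le> q"
      by (auto simp: Chains_def relation_of_def)
    show "\<exists>u\<in>S. \<forall>q\<in>C. q \<ge> u"
    proof (cases "C = {}")
      case True
      then show ?thesis
        using p by (auto simp: S_def)
    next
      case False
      \<comment> \<open>The pointwise infimum bounds the chain from below. It is finite because
        \<open>q x \<ge> - q (- x) \<ge> - p (- x)\<close> for every member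
        \<open>q\<close>.\<close>
      let ?u = "\<lambda>x. INF q\<in>C. q x"
      have sub: "sublinear q" if "q \<in> C" for q
        using that CS by (auto simp: S_def)
      have low: "- p (- x) \<le> q x" if "q \<in> C" for q x
      proof -
        have "q (- x) \<le> p (- x)"
          using that CS by (auto simp: S_def le_fun_def)
        then show ?thesis
          using sublinear_minus[OF sub[OF that], of x] by simp
      qed
      have add: "\<exists>k\<in>C. k (x + y) \<le> q x + r y" if "q \<in> C" "r \<in> C" for q r x y
        using total[OF that]
      proof
        assume "q \<le> r"
        then have "q (x + y) \<le> q x + r y"
          using sublinear_add[OF sub[OF that(1)], of x y] by (simp add: le_fun_def) (smt (verit))
        then show ?thesis
          using that by blast
      next
        assume "r \<le> q"
        then have "r (x + y) \<le> q x + r y"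
          using sublinear_add[OF sub[OF that(2)], of x y] by (simp add: le_fun_def) (smt (verit))
        then show ?thesis
          using that by blast
      qed
      have scale: "\<exists>k\<in>C. k (c *\<^sub>R x) \<le> c * q x" if "q \<in> C" "c > 0" for q c x
        using sub[OF that(1)] that by (intro bexI[of _ q]) (auto simp: sublinear_def)
      have u: "sublinear ?u"
      proof (rule sublinear_INF[where m = "\<lambda>x. - p (- x)" and F = "\<lambda>q. q"])
        show "- p (- x) \<le> q x" if "q \<in> C" for q x
          using that by (rule low)
        show "\<exists>k\<in>C. k (x + y) \<le> q x + r y" if "q \<in> C" "r \<in> C" for q r x y
          using that by (rule add)
        show "\<exists>k\<in>C. k (c *\<^sub>R x) \<le> c * q x" if "q \<in> C" "c > 0" for q c x
          using that by (rule scale)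
      qed (rule False)
      have "?u \<le> q" if "q \<in> C" for q
        using that low by (auto simp: le_fun_def intro!: cINF_lower bdd_belowI2)
      moreover from this have "?u \<le> p"
        using False CS by (auto simp: S_def intro: order_trans)
      ultimately show ?thesis
        using u by (intro bexI[of _ ?u]) (auto simp: S_def)
    qed
  qed
  then obtain f where f: "sublinear f" "f \<le> p" and min: "\<And>q. q \<in> S \<Longrightarrow> q \<le> f \<Longrightarrow> q = f"
    by (auto simp: S_def)
  have "linear f"
  proof (rule minimal_sublinear_imp_linear[OF f(1)])
    fix q assume "sublinear q" "\<And>x. q x \<le> f x"
    then show "q = f"
      using f(2) by (intro min) (auto simp: S_def le_fun_def intro: order_trans)
  qed
  with f(2) show thesis
    by (intro that) (auto simp: le_fun_def)
qed

text \<open>A Mazur--Orlicz type theorem: \<open>P\<close> plays the role of the epigraph of a convex function.\<close>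

theorem convex_epigraph_affine_minorant:
  fixes P :: "('a::real_normed_vector \<times> real) set"
  assumes "convex P" and K: "0 \<le> K"
    and low: "\<And>w s. (w, s) \<in> P \<Longrightarrow> 0 \<le> s + K * norm w"
  obtains u :: "'a \<Rightarrow>\<^sub>L real" where "\<And>w s. (w, s) \<in> P \<Longrightarrow> blinfun_apply u w \<le> s"
proof (cases "P = {}")
  case True
  then show thesis
    using that by blast
next
  case False
  define I where "I = {0::real..} \<times> P"
  \<comment> \<open>A linear \<open>f\<close> below all \<open>F (t, p)\<close> is what is wanted:
    \<open>t = 0\<close> gives \<open>f x \<le> K * norm x\<close>, hence continuity, and
    \<open>t = 1\<close> at \<open>x = - w\<close> gives \<open>f (- w) \<le> s\<close>, so
    \<open>u = - f\<close>.\<close>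
  define F where "F = (\<lambda>(t, p :: 'a \<times> real) (x :: 'a). K * norm (x + t *\<^sub>R fst p) + t * snd p)"
  have I: "I \<noteq> {}"
    using False by (auto simp: I_def)
  have F_low: "- (K * norm x) \<le> F i x" if i: "i \<in> I" for i x
  proof -
    obtain t w s where ws: "i = (t, w, s)" "t \<ge> 0" "(w, s) \<in> P"
      using i by (auto simp: I_def)
    have "t * norm w \<le> norm (x + t *\<^sub>R w) + norm x"
      using norm_triangle_ineq4[of "x + t *\<^sub>R w" x] ws by simp
    from mult_left_mono[OF this K] have "t * (K * norm w) \<le> K * norm (x + t *\<^sub>R w) + K * norm x"
      by (simp add: algebra_simps)
    moreover have "0 \<le> t * (s + K * norm w)"
      using low ws by simp
    ultimately show ?thesis
      using ws by (simp add: F_def algebra_simps)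
  qed
  have F_add: "\<exists>k\<in>I. F k (x + y) \<le> F i x + F j y" if ij: "i \<in> I" "j \<in> I" for i j x y
  proof -
    obtain t p t' p' where tp: "i = (t, p)" "t \<ge> 0" "p \<in> P" "j = (t', p')" "t' \<ge> 0" "p' \<in> P"
      using ij by (auto simp: I_def)
    \<comment> \<open>Convexity merges two weighted points of \<open>P\<close> into one of weight
      \<open>t + t'\<close>. If both weights vanish, any point of \<open>P\<close> will do.\<close>
    obtain q where q: "q \<in> P" "(t + t') *\<^sub>R q = t *\<^sub>R p + t' *\<^sub>R p'"
    proof (cases "t + t' = 0")
      case True
      then show thesis
        using tp that[of p] by (simp add: add_nonneg_eq_0_iff)
    next
      case False
      then have pos: "t + t' > 0"
        using tp by simp
      let ?q = "(t / (t + t')) *\<^sub>R p + (t' / (t + t')) *\<^sub>R p'"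
      have "?q \<in> P"
        using tp pos by (intro convexD[OF \<open>convex P\<close>]) (auto simp flip: add_divide_distrib)
      moreover have "(t + t') *\<^sub>R ?q = t *\<^sub>R p + t' *\<^sub>R p'"
        using pos by (simp add: scaleR_add_right)
      ultimately show thesis
        by (rule that)
    qed
    have fst: "(t + t') *\<^sub>R fst q = t *\<^sub>R fst p + t' *\<^sub>R fst p'"
      using arg_cong[OF q(2), of fst] by simp
    have snd: "(t + t') * snd q = t * snd p + t' * snd p'"
      using arg_cong[OF q(2), of snd] by simp
    have "norm ((x + y) + (t + t') *\<^sub>R fst q)
        \<le> norm (x + t *\<^sub>R fst p) + norm (y + t' *\<^sub>R fst p')"
      unfolding fst using norm_triangle_ineq[of "x + t *\<^sub>R fst p" "y + t' *\<^sub>R fst p'"]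
      by (simp add: algebra_simps)
    from mult_left_mono[OF this K] have "F (t + t', q) (x + y) \<le> F i x + F j y"
      using tp snd by (simp add: F_def distrib_left)
    moreover have "(t + t', q) \<in> I"
      using tp q by (simp add: I_def)
    ultimately show ?thesis
      by blast
  qed
  have F_scale: "\<exists>k\<in>I. F k (c *\<^sub>R x) \<le> c * F i x" if i: "i \<in> I" and c: "c > 0" for i c x
  proof -
    obtain t p where tp: "i = (t, p)" "t \<ge> 0" "p \<in> P"
      using i by (auto simp: I_def)
    have "c *\<^sub>R x + (c * t) *\<^sub>R fst p = c *\<^sub>R (x + t *\<^sub>R fst p)"
      by (simp add: scaleR_add_right)
    then have "norm (c *\<^sub>R x + (c * t) *\<^sub>R fst p) = c * norm (x + t *\<^sub>R fst p)"
      using c by simp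
    then have "F (c * t, p) (c *\<^sub>R x) \<le> c * F i x"
      using tp by (simp add: F_def algebra_simps)
    moreover have "(c * t, p) \<in> I"
      using tp c by (simp add: I_def)
    ultimately show ?thesis
      by blast
  qed
  have q: "sublinear (\<lambda>x. INF i\<in>I. F i x)"
    by (rule sublinear_INF[OF I F_low F_add F_scale])
  obtain f where f: "linear f" and le: "\<And>x. f x \<le> (INF i\<in>I. F i x)"
    using sublinear_has_linear_minorant[OF q] by blast
  have f_le: "f x \<le> F i x" if "i \<in> I" for i x
  proof -
    have "(INF i\<in>I. F i x) \<le> F i x"
      using that F_low by (auto intro!: cINF_lower bdd_belowI2)
    with le[of x] show ?thesis
      by (rule order_trans)
  qed
  have bound: "f x \<le> K * norm x" for x
  proof -
    obtain p where "p \<in> P"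
      using False by blast
    then show ?thesis
      using f_le[of "(0, p)" x] by (simp add: I_def F_def)
  qed
  have "\<bar>f x\<bar> \<le> K * norm x" for x
    using bound[of x] bound[of "- x"] linear_neg[OF f, of x] by simp
  then have bl: "bounded_linear f"
    using f by (intro bounded_linear_intro[where K = K])
      (auto simp: linear_add linear_scale mult.commute)
  show thesis
  proof (rule that)
    fix w s assume "(w, s) \<in> P"
    then have "f (- w) \<le> s"
      using f_le[of "(1, w, s)" "- w"] by (simp add: I_def F_def)
    then show "blinfun_apply (- Blinfun f) w \<le> s"
      using linear_neg[OF f, of w] by (simp add: bounded_linear_Blinfun_apply[OF bl] uminus_blinfun.rep_eq)
  qed
qed

section \<open>Open mapping theorem\<close>

text \<open>The Baire half of the open mapping theorem. Baire's theorem only controls closures of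
  images of balls, so preimages are found up to half the norm of the target.\<close>

lemma open_mapping_approx:
  fixes T :: "'b::real_normed_vector \<Rightarrow> 'a::banach"
  assumes T: "bounded_linear T" and S: "subspace S" and closed: "closed (T ` S)"
  obtains M where "0 \<le> M"
    and "\<And>y. y \<in> T ` S \<Longrightarrow> \<exists>x\<in>S. norm x \<le> M * norm y \<and> norm (y - T x) \<le> norm y / 2"
proof -
  interpret T: bounded_linear T
    by (rule T)
  define D where "D = T ` S"
  define C where "C n = closure (T ` (S \<inter> cball 0 (real n)))" for n
  have subD: "subspace D"
    unfolding D_def using S by (intro linear_subspace_image) (rule T.linear_axioms)
  have C_sub: "C n \<subseteq> D" for n
    unfolding C_def D_def using closed by (intro closure_minimal) auto
  have "D \<subseteq> (\<Union>n. C n)"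
  proof
    fix y assume "y \<in> D"
    then obtain x where x: "x \<in> S" "y = T x"
      by (auto simp: D_def)
    obtain n where "norm x \<le> real n"
      using real_arch_simple by blast
    with x have "y \<in> T ` (S \<inter> cball 0 (real n))"
      by auto
    then have "y \<in> C n"
      unfolding C_def by (rule subsetD[OF closure_subset])
    then show "y \<in> (\<Union>n. C n)"
      by blast
  qed
  with C_sub have D_eq: "(\<Union>n. C n) = D"
    by blast
  \<comment> \<open>\<open>D\<close> is closed in a Banach space, hence completely metrizable, and
    the closed sets \<open>C n\<close> cover it; they cannot all have empty interior in
    \<open>D\<close>.\<close>
  have "\<exists>n. top_of_set D interior_of C n \<noteq> {}"
  proof (rule ccontr)
    assume "\<not> ?thesis"
    then have "top_of_set D interior_of (\<Union>(range C)) = {}"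
    proof (intro Baire_category_alt)
      show "completely_metrizable_space (top_of_set D) \<or>
          locally_compact_space (top_of_set D) \<and> regular_space (top_of_set D)"
        using completely_metrizable_space_closedin[OF completely_metrizable_space_euclidean, of D] closed
        by (simp add: D_def)
    next
      fix E assume "\<not> (\<exists>n. top_of_set D interior_of C n \<noteq> {})" "E \<in> range C"
      then show "closedin (top_of_set D) E \<and> top_of_set D interior_of E = {}"
        using C_sub by (auto simp: C_def intro!: closed_subset)
    qed auto
    then have "D = {}"
      using interior_of_topspace[of "top_of_set D"] by (simp add: D_eq)
    then show False
      using subspace_0[OF subD] by simp
  qed
  then obtain n y0 where "y0 \<in> top_of_set D interior_of C n"
    by blast
  then obtain U where U: "openin (top_of_set D) U" "y0 \<in> U" "U \<subseteq> C n"
    by (auto simp: interior_of_def)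
  then obtain e where e: "e > 0" "ball y0 e \<inter> D \<subseteq> C n" and y0: "y0 \<in> D" "y0 \<in> C n"
    by (meson openin_contains_ball order_trans subset_iff)
  \<comment> \<open>Subtracting approximations of \<open>y0 + y\<close> and of \<open>y0\<close>
    moves the ball to the origin. The norm bound doubles to \<open>2 * real n\<close>, and two
    errors \<open>e / 8\<close> add up to \<open>e / 4\<close>.\<close>
  have near: "\<exists>x\<in>S. norm x \<le> 2 * real n \<and> norm (y - T x) \<le> e / 4"
    if y: "y \<in> D" "norm y < e" for y
  proof -
    have "y0 + y \<in> C n"
      using e(2) y y0 subspace_add[OF subD] by (auto simp: dist_norm)
    then obtain x1 where x1: "x1 \<in> S" "norm x1 \<le> real n" "dist (T x1) (y0 + y) < e / 8"
      unfolding C_def using e(1)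
      by (auto simp: closure_approachable dest!: spec[of _ "e / 8"])
    obtain x2 where x2: "x2 \<in> S" "norm x2 \<le> real n" "dist (T x2) y0 < e / 8"
      using y0(2) e(1) unfolding C_def
      by (auto simp: closure_approachable dest!: spec[of _ "e / 8"])
    have "y - T (x1 - x2) = (T x2 - y0) - (T x1 - (y0 + y))"
      by (simp add: T.diff)
    then have "norm (y - T (x1 - x2)) \<le> norm (T x2 - y0) + norm (T x1 - (y0 + y))"
      by (metis norm_triangle_ineq4)
    also have "\<dots> \<le> e / 4"
      using x1 x2 by (simp add: dist_norm)
    finally have "norm (y - T (x1 - x2)) \<le> e / 4" .
    moreover have "norm (x1 - x2) \<le> 2 * real n"
      using norm_triangle_ineq4[of x1 x2] x1 x2 by simp
    ultimately show ?thesis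
      using x1 x2 subspace_diff[OF S] by blast
  qed
  show thesis
  proof (rule that[of "4 * real n / e"])
    show "0 \<le> 4 * real n / e"
      using e by simp
  next
    fix y assume y: "y \<in> T ` S"
    show "\<exists>x\<in>S. norm x \<le> 4 * real n / e * norm y \<and> norm (y - T x) \<le> norm y / 2"
    proof (cases "y = 0")
      case True
      then show ?thesis
        using subspace_0[OF S] by (intro bexI[of _ 0]) (auto simp: T.zero)
    next
      case False
      \<comment> \<open>Dividing by \<open>c\<close> brings \<open>y\<close> to norm
        \<open>e / 2\<close>, inside the range of \<open>near\<close>. Scaling back turns
        \<open>e / 4\<close> into \<open>norm y / 2\<close> and \<open>2 * real n\<close> into
        \<open>4 * real n / e * norm y\<close>.\<close>
      define c where "c = 2 * norm y / e"
      have c: "c > 0"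
        using False e by (simp add: c_def)
      have yc: "norm (inverse c *\<^sub>R y) = e / 2"
        using False e by (simp add: c_def field_simps)
      have "\<exists>x\<in>S. norm x \<le> 2 * real n \<and> norm (inverse c *\<^sub>R y - T x) \<le> e / 4"
      proof (rule near)
        show "inverse c *\<^sub>R y \<in> D"
          using y by (intro subspace_scale[OF subD]) (simp add: D_def)
        show "norm (inverse c *\<^sub>R y) < e"
          using e by (subst yc) simp
      qed
      then obtain x where x: "x \<in> S" "norm x \<le> 2 * real n" "norm (inverse c *\<^sub>R y - T x) \<le> e / 4"
        by blast
      have "y - T (c *\<^sub>R x) = c *\<^sub>R (inverse c *\<^sub>R y - T x)"
        using c by (simp add: T.scaleR scaleR_diff_right)
      then have "norm (y - T (c *\<^sub>R x)) = c * norm (inverse c *\<^sub>R y - T x)"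
        using c by simp
      also have "\<dots> \<le> c * (e / 4)"
        using x c by (intro mult_left_mono) auto
      also have "\<dots> = norm y / 2"
        using e by (simp add: c_def)
      finally have "norm (y - T (c *\<^sub>R x)) \<le> norm y / 2" .
      moreover have "norm (c *\<^sub>R x) \<le> 4 * real n / e * norm y"
      proof -
        have "norm (c *\<^sub>R x) \<le> c * (2 * real n)"
          using x c by simp
        then show ?thesis
          by (simp add: c_def field_simps)
      qed
      ultimately show ?thesis
        using subspace_scale[OF S x(1)] by blast
    qed
  qed
qed

text \<open>Approximate solving is iterated on the residuals. These halve each time, so the
  corrections form an absolutely convergent series with total norm at most
  \<open>2 * M * norm y\<close>, whose sum stays in the closed subspace \<open>S\<close>.\<close>

theorem open_mapping_bound:
  fixes T :: "'b::banach \<Rightarrow> 'a::banach"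
  assumes T: "bounded_linear T" and S: "subspace S" "closed S" and closed: "closed (T ` S)"
  obtains M where "0 \<le> M" and "\<And>y. y \<in> T ` S \<Longrightarrow> \<exists>x\<in>S. T x = y \<and> norm x \<le> M * norm y"
proof -
  interpret T: bounded_linear T
    by (rule T)
  obtain M where M: "0 \<le> M"
    and "\<And>y. y \<in> T ` S \<Longrightarrow> \<exists>x\<in>S. norm x \<le> M * norm y \<and> norm (y - T x) \<le> norm y / 2"
    using open_mapping_approx[OF T S(1) closed] by blast
  then obtain g where g: "\<And>y. y \<in> T ` S \<Longrightarrow> g y \<in> S"
    and g_norm: "\<And>y. y \<in> T ` S \<Longrightarrow> norm (g y) \<le> M * norm y"
    and g_err: "\<And>y. y \<in> T ` S \<Longrightarrow> norm (y - T (g y)) \<le> norm y / 2"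
    by metis
  have subD: "subspace (T ` S)"
    using S(1) by (intro linear_subspace_image) (rule T.linear_axioms)
  show thesis
  proof (rule that[of "2 * M"])
    show "0 \<le> 2 * M"
      using M by simp
  next
    fix y assume y: "y \<in> T ` S"
    \<comment> \<open>\<open>r k\<close> is the part of \<open>y\<close> left after \<open>k\<close>
      corrections; the partial sums of \<open>T (g (r k))\<close> telescope to
      \<open>y - r n\<close>.\<close>
    define r where "r k = ((\<lambda>z. z - T (g z)) ^^ k) y" for k
    have r_Suc: "r (Suc k) = r k - T (g (r k))" for k
      by (simp add: r_def)
    have r_0: "r 0 = y"
      by (simp add: r_def)
    have r_in: "r k \<in> T ` S" for k
      by (induction k) (use y g subspace_diff[OF subD] in \<open>auto simp: r_0 r_Suc\<close>)
    have r_norm: "norm (r k) \<le> norm y * (1/2) ^ k" for k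
    proof (induction k)
      case (Suc k)
      then show ?case
        using g_err[OF r_in, of k] by (simp add: r_Suc)
    qed (simp add: r_0)
    have gr_norm: "norm (g (r k)) \<le> M * norm y * (1/2) ^ k" for k
      using g_norm[OF r_in, of k] mult_left_mono[OF r_norm[of k] M] by (simp add: mult.assoc)
    have geo: "(\<lambda>k. M * norm y * (1/2) ^ k) sums (M * norm y * 2)"
      using sums_mult[OF geometric_sums[of "1/2 :: real"], of "M * norm y"] by simp
    have sum_abs: "summable (\<lambda>k. norm (g (r k)))"
      using gr_norm by (intro summable_comparison_test'[OF sums_summable[OF geo]]) simp
    then have sum: "summable (\<lambda>k. g (r k))"
      by (rule summable_norm_cancel)
    define x where "x = (\<Sum>k. g (r k))"
    have lim: "(\<lambda>n. \<Sum>k<n. g (r k)) \<longlonglongrightarrow> x"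
      unfolding x_def using sum by (rule summable_LIMSEQ)
    have "x \<in> S"
      using g[OF r_in] by (intro closed_sequentially[OF S(2) _ lim] subspace_sum[OF S(1)])
    moreover have "T x = y"
    proof -
      have "T (\<Sum>k<n. g (r k)) = y - r n" for n
        by (induction n) (auto simp: T.zero T.add r_0 r_Suc)
      then have "(\<lambda>n. y - r n) \<longlonglongrightarrow> T x"
        using T.tendsto[OF lim] by simp
      moreover have "r \<longlonglongrightarrow> 0"
      proof (rule Lim_null_comparison)
        show "\<forall>\<^sub>F k in sequentially. norm (r k) \<le> norm y * (1/2) ^ k"
          using r_norm by simp
        show "(\<lambda>k. norm y * (1/2) ^ k) \<longlonglongrightarrow> 0"
          by (intro tendsto_mult_right_zero LIMSEQ_power_zero) simp
      qed
      then have "(\<lambda>n. y - r n) \<longlonglongrightarrow> y - 0"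
        by (intro tendsto_intros)
      ultimately show ?thesis
        using LIMSEQ_unique by fastforce
    qed
    moreover have "norm x \<le> 2 * M * norm y"
    proof -
      have "norm x \<le> (\<Sum>k. norm (g (r k)))"
        unfolding x_def using sum_abs by (rule summable_norm)
      also have "\<dots> \<le> (\<Sum>k. M * norm y * (1/2) ^ k)"
        using gr_norm sum_abs sums_summable[OF geo] by (intro suminf_le)
      also have "\<dots> = 2 * M * norm y"
        using sums_unique[OF geo] by simp
      finally show ?thesis .
    qed
    ultimately show "\<exists>x\<in>S. T x = y \<and> norm x \<le> 2 * M * norm y"
      by blast
  qed
qed

section \<open>Monotone linear relations\<close>

lemma monotone_op_iff:
  "monotone_op A \<longleftrightarrow>
    (\<forall>p\<in>gra A. \<forall>q\<in>gra A. 0 \<le> blinfun_apply (snd p - snd q) (fst p - fst q))"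
  by (simp add: monotone_op_def case_prod_beta)

lemma monotone_opD:
  assumes "monotone_op A" "p \<in> gra A" "q \<in> gra A"
  shows "0 \<le> blinfun_apply (snd p - snd q) (fst p - fst q)"
  using assms by (simp add: monotone_op_iff)

text \<open>Adjoining \<open>(z, u)\<close> to the graph preserves monotonicity, so by maximality
  the point was already there.\<close>

lemma maximally_monotone_memI:
  assumes A: "maximally_monotone A"
    and rel: "\<And>p. p \<in> gra A \<Longrightarrow> 0 \<le> blinfun_apply (u - snd p) (z - fst p)"
  shows "(z, u) \<in> gra A"
proof (rule ccontr)
  assume notin: "(z, u) \<notin> gra A"
  define C where "C = A(z := insert u (A z))"
  have C: "gra C = insert (z, u) (gra A)"
    by (auto simp: gra_def C_def split: if_splits)
  have rel': "0 \<le> blinfun_apply (snd p - u) (fst p - z)" if "p \<in> gra A" for p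
  proof -
    have "blinfun_apply (snd p - u) (fst p - z) = blinfun_apply (u - snd p) (z - fst p)"
      by (simp add: blinfun.diff_left blinfun.diff_right)
    with rel[OF that] show ?thesis
      by simp
  qed
  have "monotone_op A"
    using A by (simp add: maximally_monotone_def)
  then have "monotone_op C"
    unfolding monotone_op_iff C using rel rel' by simp
  moreover have "gra A \<subset> gra C"
    using notin C by auto
  ultimately show False
    using A by (auto simp: maximally_monotone_def)
qed

text \<open>By maximality the graph is exactly the set of points monotonically related to all of it,
  an intersection of closed sets.\<close>

lemma closed_gra:
  assumes A: "maximally_monotone A"
  shows "closed (gra A)"
proof -
  have "gra A = (\<Inter>p\<in>gra A. {q. 0 \<le> blinfun_apply (snd q - snd p) (fst q - fst p)})"
    (is "_ = ?R")
  proof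
    show "gra A \<subseteq> ?R"
      using monotone_opD[of A] A by (auto simp: maximally_monotone_def)
    show "?R \<subseteq> gra A"
    proof
      fix q assume "q \<in> ?R"
      then have "(fst q, snd q) \<in> gra A"
        by (intro maximally_monotone_memI[OF A]) blast
      then show "q \<in> gra A"
        by simp
    qed
  qed
  also have "closed \<dots>"
    by (intro closed_INT ballI closed_Collect_le continuous_intros)
  finally show ?thesis .
qed

text \<open>By bilinearity and \<open>s + t = 1\<close>, the convexity defect is exactly
  \<open>s * t\<close> times the pairing of \<open>p - q\<close> with itself, which monotonicity
  makes nonnegative.\<close>

lemma pairing_convex_on_gra:
  assumes mono: "monotone_op A" and lin: "linear_relation A"
    and p: "p \<in> gra A" and q: "q \<in> gra A" and st: "0 \<le> s" "0 \<le> t" "s + t = 1"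
  shows "blinfun_apply (snd (s *\<^sub>R p + t *\<^sub>R q)) (fst (s *\<^sub>R p + t *\<^sub>R q))
    \<le> s * blinfun_apply (snd p) (fst p) + t * blinfun_apply (snd q) (fst q)"
proof -
  have "0 \<le> s * t * blinfun_apply (snd p - snd q) (fst p - fst q)"
    using monotone_opD[OF mono p q] st by simp
  also have "\<dots> = s * blinfun_apply (snd p) (fst p) + t * blinfun_apply (snd q) (fst q)
      - blinfun_apply (snd (s *\<^sub>R p + t *\<^sub>R q)) (fst (s *\<^sub>R p + t *\<^sub>R q))"
  proof -
    have t: "t = 1 - s"
      using st by simp
    show ?thesis
      unfolding t by (simp add: blinfun.bilinear_simps algebra_simps)
  qed
  finally show ?thesis
    by simp
qed

section \<open>Existence of the splitting functional\<close>

lemma splitting_functional: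
  fixes A B :: "'a::banach set_valued" and z :: 'a and v :: "'a dual"
  assumes A: "maximally_monotone A" "linear_relation A"
    and B: "maximally_monotone B" "linear_relation B"
    and closed: "closed {a - b | a b. a \<in> op_dom A \<and> b \<in> op_dom B}"
    and rel: "\<And>p. p \<in> gra (op_sum A B) \<Longrightarrow> 0 \<le> blinfun_apply (v - snd p) (z - fst p)"
  obtains u where "\<And>p q. p \<in> gra A \<Longrightarrow> q \<in> gra B \<Longrightarrow>
    0 \<le> blinfun_apply (u - snd p) (z - fst p) + blinfun_apply ((v - u) - snd q) (z - fst q)"
proof -
  have mono: "monotone_op A" "monotone_op B"
    using A B by (auto simp: maximally_monotone_def)
  have sub: "subspace (gra A)" "subspace (gra B)"
    using A B by (auto simp: linear_relation_def)
  \<comment> \<open>Expanding the required inequality and isolating \<open>u\<close> turns it into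
    \<open>u (fst p - fst q) \<le> g p q\<close>.\<close>
  define g where "g p q = blinfun_apply (snd p) (fst p) - blinfun_apply (snd p) z
      + blinfun_apply (snd q) (fst q) - blinfun_apply (snd q) z
      - blinfun_apply v (fst q) + blinfun_apply v z"
    for p q :: "'a \<times> 'a dual"
  define T where "T = (\<lambda>x :: ('a \<times> 'a dual) \<times> ('a \<times> 'a dual). fst (fst x) - fst (snd x))"
  define S where "S = gra A \<times> gra B"
  have T: "bounded_linear T"
    unfolding T_def by (intro bounded_linear_intros)
  have S: "subspace S" "closed S"
    unfolding S_def using A B sub by (auto intro!: subspace_Times closed_Times closed_gra)
  have TS: "T ` S = {a - b | a b. a \<in> op_dom A \<and> b \<in> op_dom B}"
  proof (intro set_eqI iffI)
    fix w assume "w \<in> {a - b | a b. a \<in> op_dom A \<and> b \<in> op_dom B}"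
    then obtain a b a' b' where "w = a - b" "(a, a') \<in> gra A" "(b, b') \<in> gra B"
      by (auto simp: op_dom_def gra_def)
    then show "w \<in> T ` S"
      by (intro image_eqI[of _ _ "((a, a'), (b, b'))"]) (auto simp: T_def S_def)
  next
    fix w assume "w \<in> T ` S"
    then obtain a a' b b' where "w = a - b" "a' \<in> A a" "b' \<in> B b"
      by (auto simp: T_def S_def gra_def)
    then show "w \<in> {a - b | a b. a \<in> op_dom A \<and> b \<in> op_dom B}"
      unfolding op_dom_def by blast
  qed
  have subD: "subspace (T ` S)"
    using S(1) T by (intro linear_subspace_image bounded_linear.linear)
  obtain M where M: "0 \<le> M" "\<And>y. y \<in> T ` S \<Longrightarrow> \<exists>x\<in>S. T x = y \<and> norm x \<le> M * norm y"
    using open_mapping_bound[OF T S] closed TS by metis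
  \<comment> \<open>The six summands bound the six terms of \<open>g p q\<close> one by one when
    \<open>norm p \<le> M\<close> and \<open>norm q \<le> M\<close>.\<close>
  define K where "K = M * M + M * norm z + M * M + M * norm z + norm v * M + norm v * norm z"
  have K: "0 \<le> K"
    using M(1) by (simp add: K_def)
  have g_upper: "g p q \<le> K" if "norm (p, q) \<le> M" for p q
  proof -
    have pq: "norm p \<le> M" "norm q \<le> M"
      using that norm_fst_le[of p q] norm_snd_le[of q p] by auto
    have pair: "\<bar>blinfun_apply f x\<bar> \<le> a * b" if "norm f \<le> a" "norm x \<le> b" for f :: "'a dual" and x a b
      using norm_blinfun[of f x] mult_mono'[OF that] by simp
    have "norm (fst p) \<le> M" "norm (snd p) \<le> M" "norm (fst q) \<le> M" "norm (snd q) \<le> M"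
      using pq norm_fst_le[of "fst p" "snd p"] norm_snd_le[of "snd p" "fst p"]
        norm_fst_le[of "fst q" "snd q"] norm_snd_le[of "snd q" "fst q"] by auto
    note b = this
    show ?thesis
      using pair[OF b(2,1)] pair[OF b(4,3)] pair[OF b(2) order_refl[of "norm z"]]
        pair[OF b(4) order_refl[of "norm z"]] pair[OF order_refl[of "norm v"] b(3)]
        pair[OF order_refl[of "norm v"] order_refl[of "norm z"]]
      unfolding g_def K_def by linarith
  qed
  have g_convex: "g (s *\<^sub>R p + t *\<^sub>R p') (s *\<^sub>R q + t *\<^sub>R q') \<le> s * g p q + t * g p' q'"
    if "p \<in> gra A" "p' \<in> gra A" "q \<in> gra B" "q' \<in> gra B" and st: "0 \<le> s" "0 \<le> t" "s + t = 1"
    for p p' q q' s t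
  proof -
    have vz: "blinfun_apply v z = s * blinfun_apply v z + t * blinfun_apply v z"
      using st by (metis distrib_right mult_1)
    show ?thesis
      using pairing_convex_on_gra[OF mono(1) A(2) that(1,2) st]
        pairing_convex_on_gra[OF mono(2) B(2) that(3,4) st] vz
      unfolding g_def by (simp add: blinfun.add_left blinfun.add_right blinfun.scaleR_left
          blinfun.scaleR_right algebra_simps)
  qed
  have g_diag: "0 \<le> g p q" if pq: "p \<in> gra A" "q \<in> gra B" and eq: "fst p = fst q" for p q
  proof -
    have "(fst p, snd p + snd q) \<in> gra (op_sum A B)"
      using pq eq by (cases p; cases q) (auto simp: gra_def op_sum_def)
    from rel[OF this] show ?thesis
      using eq by (simp add: g_def blinfun.bilinear_simps algebra_simps)
  qed
  have g_lower: "0 \<le> g p q + K * norm (fst p - fst q)" if pq: "p \<in> gra A" "q \<in> gra B" for p q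
  proof (cases "fst p = fst q")
    case True
    then show ?thesis
      using g_diag[OF pq] by simp
  next
    case False
    define w where "w = fst p - fst q"
    define n where "n = norm w"
    have n: "n > 0"
      using False by (simp add: n_def w_def)
    have "w \<in> T ` S"
      using pq by (intro image_eqI[of _ _ "(p, q)"]) (auto simp: w_def T_def S_def)
    \<comment> \<open>The opposite unit vector has a preimage \<open>(p', q')\<close> of norm at
      most \<open>M\<close>, where \<open>g\<close> is at most \<open>K\<close>.\<close>
    then have "- ((1 / n) *\<^sub>R w) \<in> T ` S"
      by (intro subspace_neg subspace_scale subD)
    then have "\<exists>x\<in>S. T x = - ((1 / n) *\<^sub>R w) \<and> norm x \<le> M * norm (- ((1 / n) *\<^sub>R w))"
      by (rule M(2))
    then obtain p' q' where pq': "p' \<in> gra A" "q' \<in> gra B"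
      and w': "fst p' - fst q' = - ((1 / n) *\<^sub>R w)" and "norm (p', q') \<le> M"
      using n by (auto simp: S_def T_def n_def)
    \<comment> \<open>These weights make the differences cancel, since \<open>s *\<^sub>R w\<close>
      and \<open>t *\<^sub>R ((1 / n) *\<^sub>R w)\<close> agree. The combination lies on the
      diagonal, where \<open>g \<ge> 0\<close>, and convexity gives
      \<open>0 \<le> s * (g p q + K * n)\<close>.\<close>
    define s where "s = 1 / (1 + n)"
    define t where "t = n / (1 + n)"
    have st: "0 \<le> s" "0 \<le> t" "s + t = 1" "t = s * n" "s > 0"
      using n by (auto simp: s_def t_def field_simps)
    let ?p = "s *\<^sub>R p + t *\<^sub>R p'" and ?q = "s *\<^sub>R q + t *\<^sub>R q'"
    have "fst ?p - fst ?q = s *\<^sub>R (fst p - fst q) + t *\<^sub>R (fst p' - fst q')"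
      by (simp add: algebra_simps)
    also have "\<dots> = 0"
      using n by (simp add: w' st(4) flip: w_def)
    finally have "fst ?p = fst ?q"
      by simp
    moreover have "?p \<in> gra A" "?q \<in> gra B"
      using pq pq' sub by (auto intro!: subspace_add subspace_scale)
    ultimately have "0 \<le> g ?p ?q"
      by (intro g_diag)
    also have "\<dots> \<le> s * g p q + t * g p' q'"
      using pq pq' st by (intro g_convex)
    also have "\<dots> \<le> s * g p q + t * K"
      using g_upper[OF \<open>norm (p', q') \<le> M\<close>] st by (simp add: mult_left_mono)
    also have "\<dots> = s * (g p q + K * n)"
      by (simp add: st(4) algebra_simps)
    finally show ?thesis
      using st(5) by (simp add: zero_le_mult_iff n_def w_def)
  qed
  \<comment> \<open>The epigraph of \<open>g\<close> pushed forward along the difference map; a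
    linear \<open>u\<close> with \<open>u w \<le> s\<close> on \<open>P\<close> is the desired
    splitting.\<close>
  define P where "P = {x. \<exists>p\<in>gra A. \<exists>q\<in>gra B. fst x = fst p - fst q \<and> g p q \<le> snd x}"
  have "convex P"
  proof (rule convexI)
    fix x y s t
    assume "x \<in> P" "y \<in> P" and st: "0 \<le> s" "0 \<le> t" "s + t = (1::real)"
    then obtain p q p' q' where pq: "p \<in> gra A" "q \<in> gra B" "fst x = fst p - fst q" "g p q \<le> snd x"
      "p' \<in> gra A" "q' \<in> gra B" "fst y = fst p' - fst q'" "g p' q' \<le> snd y"
      by (auto simp: P_def)
    let ?p = "s *\<^sub>R p + t *\<^sub>R p'" and ?q = "s *\<^sub>R q + t *\<^sub>R q'"
    have "g ?p ?q \<le> s * g p q + t * g p' q'"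
      using pq st by (intro g_convex)
    also have "\<dots> \<le> s * snd x + t * snd y"
      using pq st by (intro add_mono mult_left_mono)
    finally have "g ?p ?q \<le> snd (s *\<^sub>R x + t *\<^sub>R y)"
      by simp
    moreover have "fst (s *\<^sub>R x + t *\<^sub>R y) = fst ?p - fst ?q"
      by (simp add: pq(3,7) scaleR_diff_right)
    moreover have "?p \<in> gra A" "?q \<in> gra B"
      using pq sub by (auto intro!: subspace_add subspace_scale)
    ultimately show "s *\<^sub>R x + t *\<^sub>R y \<in> P"
      unfolding P_def mem_Collect_eq by blast
  qed
  moreover have "0 \<le> s + K * norm w" if ws: "(w, s) \<in> P" for w s
  proof -
    obtain p q where "p \<in> gra A" "q \<in> gra B" "w = fst p - fst q" "g p q \<le> s"
      using ws unfolding P_def mem_Collect_eq fst_conv snd_conv by blast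
    then show ?thesis
      using g_lower[of p q] by simp
  qed
  ultimately obtain u where u: "\<And>w s. (w, s) \<in> P \<Longrightarrow> blinfun_apply u w \<le> s"
    using convex_epigraph_affine_minorant[OF _ K, of P] by blast
  show thesis
  proof (rule that)
    fix p q assume "p \<in> gra A" "q \<in> gra B"
    then have "(fst p - fst q, g p q) \<in> P"
      unfolding P_def mem_Collect_eq fst_conv snd_conv by blast
    from u[OF this]
    show "0 \<le> blinfun_apply (u - snd p) (z - fst p) + blinfun_apply ((v - u) - snd q) (z - fst q)"
      by (simp add: g_def blinfun.bilinear_simps algebra_simps)
  qed
qed

section \<open>From the splitting to maximality of the sum\<close>

text \<open>A negative first term at some \<open>p\<close> would make the second positive for every
  \<open>q\<close>. Then \<open>(z, v)\<close> lies in \<open>gra B\<close> by maximality, yet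
  \<open>q = (z, v)\<close> makes the second term zero.\<close>

lemma maximally_monotone_pair_memI:
  assumes A: "maximally_monotone A" and B: "maximally_monotone B"
    and sum: "\<And>p q. p \<in> gra A \<Longrightarrow> q \<in> gra B \<Longrightarrow>
      0 \<le> blinfun_apply (u - snd p) (z - fst p) + blinfun_apply (v - snd q) (z - fst q)"
  shows "(z, u) \<in> gra A \<and> (z, v) \<in> gra B"
proof -
  have zu: "(z, u) \<in> gra A"
  proof (rule ccontr)
    assume "(z, u) \<notin> gra A"
    then obtain p where p: "p \<in> gra A" "blinfun_apply (u - snd p) (z - fst p) < 0"
      using maximally_monotone_memI[OF A, of u z] by (meson not_le)
    then have pos: "0 < blinfun_apply (v - snd q) (z - fst q)" if "q \<in> gra B" for q
      using sum[OF p(1) that] by simp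
    then have "(z, v) \<in> gra B"
      by (intro maximally_monotone_memI[OF B]) (rule less_imp_le)
    from pos[OF this] show False
      by simp
  qed
  \<comment> \<open>At \<open>p = (z, u)\<close> the first term vanishes, which leaves the relation
    needed for \<open>B\<close>.\<close>
  moreover have "(z, v) \<in> gra B"
    using sum[OF zu] by (intro maximally_monotone_memI[OF B]) simp
  ultimately show ?thesis ..
qed

lemma monotone_op_sum:
  assumes A: "monotone_op A" and B: "monotone_op B"
  shows "monotone_op (op_sum A B)"
proof -
  have "0 \<le> blinfun_apply (a + b - (a' + b')) (x - y)"
    if "a \<in> A x" "b \<in> B x" "a' \<in> A y" "b' \<in> B y" for a b a' b' x y
  proof -
    have "0 \<le> blinfun_apply (a - a') (x - y)" "0 \<le> blinfun_apply (b - b') (x - y)"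
      using monotone_opD[OF A, of "(x, a)" "(y, a')"] monotone_opD[OF B, of "(x, b)" "(y, b')"] that
      by (auto simp: gra_def)
    then show ?thesis
      by (simp add: blinfun.diff_left blinfun.add_left)
  qed
  then show ?thesis
    by (auto simp: monotone_op_def gra_def op_sum_def)
qed

theorem theorem5p5:
  fixes A B :: "'a::banach set_valued"
  assumes "maximally_monotone A" and "linear_relation A"
    and "maximally_monotone B" and "linear_relation B"
    and "closed {a - b | a b. a \<in> op_dom A \<and> b \<in> op_dom B}"
  shows "maximally_monotone (op_sum A B)"
  unfolding maximally_monotone_def
proof (intro conjI notI)
  show "monotone_op (op_sum A B)"
    using assms(1,3) by (intro monotone_op_sum) (auto simp: maximally_monotone_def)
next
  assume "\<exists>C. monotone_op C \<and> gra (op_sum A B) \<subset> gra C"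
  then obtain C z v where C: "monotone_op C" "gra (op_sum A B) \<subset> gra C"
    and zv: "(z, v) \<in> gra C" "(z, v) \<notin> gra (op_sum A B)"
    by auto
  \<comment> \<open>A point of a strictly larger monotone graph is monotonically related to the sum;
    splitting \<open>v\<close> will place it in the sum's graph after all.\<close>
  have "0 \<le> blinfun_apply (v - snd p) (z - fst p)" if "p \<in> gra (op_sum A B)" for p
    using monotone_opD[OF C(1) zv(1), of p] that C(2) by auto
  then obtain u where "\<And>p q. p \<in> gra A \<Longrightarrow> q \<in> gra B \<Longrightarrow>
      0 \<le> blinfun_apply (u - snd p) (z - fst p) + blinfun_apply ((v - u) - snd q) (z - fst q)"
    using splitting_functional[OF assms, of v z] by blast
  then have "(z, u) \<in> gra A \<and> (z, v - u) \<in> gra B"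
    by (intro maximally_monotone_pair_memI[OF assms(1,3)])
  then have "(z, u + (v - u)) \<in> gra (op_sum A B)"
    unfolding gra_def op_sum_def by blast
  with zv(2) show False
    by simp
qed

end
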